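(* Let $S$ be an arbitrary quantum system with finite-dimensional Hilbert space and Hamiltonian $H_s$, coupled to a heat reservoir initially in a thermal state at temperature $T$. Let $\rho_s(t)$ be the density matrix of the system at time $t$, and let $\rho_s^\beta=\exp(-\beta H_s)/Z_s$ be the Gibbs state of the system, with $Z_s=\mathrm{tr}\{\exp(-\beta H_s)\}$ and $\beta=1/T$. Define the thermodynamic force and the thermodynamic flow by $$F_{th}=\frac{1}{\rho_s^\beta}\bigl(\ln\rho_s^\beta-\ln\rho_s(t)\bigr),\qquad V_{th}=\dot\rho_s(t)\,\rho_s^\beta ,$$ where $\frac{1}{\rho_s^\beta}$ is the inverse operator $(\rho_s^\beta)^{-1}$, multiplying from the left. Then the rate of entropy production of the system is $$\frac{d_iS}{dt}=\mathrm{tr}\{V_{th}F_{th}\}=\mathrm{tr}\Bigl\{\bigl(\dot\rho_s(t)\rho_s^\beta\bigr)\Bigl(\frac{1}{\rho_s^\beta}\bigl(\ln\rho_s^\beta-\ln\rho_s(t)\bigr)\Bigr)\Bigr\}.$$ If the system Hamiltonian is time-dependent, $\rho_s^\beta$ is replaced by $\rho_s^\beta(t)=\exp(-\beta H_s(t))/Z_s(t)$.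
   Context: Units are such that Boltzmann's constant is $1$. The system and reservoir together form a closed system that evolves unitarily. The system itself evolves by $\rho_s(t)=\Lambda_t[\rho_s(0)]$, where the $\Lambda_t$ are completely positive trace-preserving maps; dots denote time derivatives. The entropy of the system is $S(t)=-\mathrm{tr}\{\rho_s(t)\ln\rho_s(t)\}$, and its rate of change is taken to be given, for any quantum dynamical process on a finite-dimensional Hilbert space, by $$\frac{dS}{dt}=-\mathrm{tr}\{\dot\rho_s(t)\ln\rho_s(t)\}.$$ The rate of entropy production $\frac{d_iS}{dt}$ is defined by the entropy balance $$-\mathrm{tr}\{\dot\rho_s(t)\ln\rho_s(t)\}=\frac{d_iS}{dt}+\frac{\langle\dot Q\rangle}{T},\qquad \langle\dot Q\rangle=\mathrm{tr}\{\dot\rho_s(t)H_s\},$$ where $\langle\dot Q\rangle$ is the rate of heat exchanged between the system and the reservoir. The operator $A=\ln\rho_s^\beta-\ln\rho_s(t)$ (the quantum affinity, so that $F_{th}=A/\rho_s^\beta$) is considered also for density matrices with zero eigenvalues, in which case the affinity is regarded as infinite. *)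

theory Defs
  imports "HOL-Analysis.Analysis"
begin

section \<open>Operators on a finite-dimensional Hilbert space\<close>

type_synonym 'n cmat = "complex ^ 'n ^ 'n"

definition cinner :: "complex ^ 'n::finite \<Rightarrow> complex ^ 'n \<Rightarrow> complex" where
  "cinner v w = (\<Sum>i\<in>UNIV. cnj (v $ i) * w $ i)"

definition hermitian :: "'n::finite cmat \<Rightarrow> bool" where
  "hermitian A \<longleftrightarrow> (\<forall>i j. A $ i $ j = cnj (A $ j $ i))"

definition pos_semidef :: "'n::finite cmat \<Rightarrow> bool" where
  "pos_semidef A \<longleftrightarrow> (\<forall>v. cinner v (A *v v) \<in> \<real>\<^sub>\<ge>\<^sub>0)"

definition density_matrix :: "'n::finite cmat \<Rightarrow> bool" where
  "density_matrix \<rho> \<longleftrightarrow> pos_semidef \<rho> \<and> trace \<rho> = 1"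

definition mexp :: "'n::finite cmat \<Rightarrow> 'n cmat" where
  "mexp A = (\<Sum>k. ((**) A ^^ k) (mat 1) /\<^sub>R fact k)"

text \<open>
  Logarithms are taken by the spectral calculus: if \<open>A\<close> is Hermitian with eigenvalues \<open>x\<close> and
  orthogonal eigenprojections \<open>P\<^sub>x\<close>, then \<open>ln A = (\<Sum>x. ln x P\<^sub>x)\<close>.
\<close>

definition eigenspace :: "'n::finite cmat \<Rightarrow> real \<Rightarrow> (complex ^ 'n) set" where
  "eigenspace A x = {v. A *v v = complex_of_real x *s v}"

definition real_eigenvalues :: "'n::finite cmat \<Rightarrow> real set" where
  "real_eigenvalues A = {x. \<exists>v. v \<noteq> 0 \<and> v \<in> eigenspace A x}"

definition eigenprojection :: "'n::finite cmat \<Rightarrow> real \<Rightarrow> 'n cmat" where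
  "eigenprojection A x =
     (THE P. hermitian P \<and> P ** P = P \<and> range ((*v) P) = eigenspace A x)"

text \<open>
  Since \<open>ln 0 = 0\<close> in HOL, \<open>mlog A\<close> is the genuine logarithm only if all eigenvalues are
  positive; for a singular density matrix it is the logarithm restricted to the support, and
  \<open>xlog\<close> below restores the infinite part.
\<close>

definition mlog :: "'n::finite cmat \<Rightarrow> 'n cmat" where
  "mlog A = (\<Sum>x\<in>real_eigenvalues A. ln x *\<^sub>R eigenprojection A x)"

section \<open>Completely positive trace-preserving maps\<close>

text \<open>
  A positive operator on \<open>\<complex>\<^sup>m \<otimes> \<complex>\<^sup>n\<close> is an \<open>m \<times> m\<close> array of \<open>n \<times> n\<close> blocks \<open>X i j\<close>, on which
  \<open>id \<otimes> \<Lambda>\<close> acts blockwise.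
\<close>

definition block_pos_semidef :: "nat \<Rightarrow> (nat \<Rightarrow> nat \<Rightarrow> 'n::finite cmat) \<Rightarrow> bool" where
  "block_pos_semidef m X \<longleftrightarrow>
     (\<forall>v. (\<Sum>i<m. \<Sum>j<m. cinner (v i) (X i j *v v j)) \<in> \<real>\<^sub>\<ge>\<^sub>0)"

definition completely_positive :: "('n::finite cmat \<Rightarrow> 'n cmat) \<Rightarrow> bool" where
  "completely_positive \<Lambda> \<longleftrightarrow>
     (\<forall>m X. block_pos_semidef m X \<longrightarrow> block_pos_semidef m (\<lambda>i j. \<Lambda> (X i j)))"

definition cmat_linear :: "('n::finite cmat \<Rightarrow> 'n cmat) \<Rightarrow> bool" where
  "cmat_linear \<Lambda> \<longleftrightarrow> (\<forall>X Y. \<Lambda> (X + Y) = \<Lambda> X + \<Lambda> Y) \<and>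
     (\<forall>c X. \<Lambda> (\<chi> i j. c * X $ i $ j) = (\<chi> i j. c * \<Lambda> X $ i $ j))"

definition cptp :: "('n::finite cmat \<Rightarrow> 'n cmat) \<Rightarrow> bool" where
  "cptp \<Lambda> \<longleftrightarrow> cmat_linear \<Lambda> \<and> completely_positive \<Lambda> \<and> (\<forall>X. trace (\<Lambda> X) = trace X)"

section \<open>System coupled to a thermal reservoir\<close>

text \<open>
  The reservoir Hilbert space is \<open>\<ell>\<^sup>2('r)\<close>, of arbitrary dimension, written in an orthonormal
  eigenbasis of the reservoir Hamiltonian, whose eigenvalues are \<open>E\<close>. Such a basis exists
  whenever the Gibbs operator is trace class, since the latter is then compact; the thermal state
  is diagonal in it, with the weights below. Operators on the tensor product of the two spaces
  are given by their matrix elements in the product basis.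
\<close>

definition reservoir_weight :: "real \<Rightarrow> ('r \<Rightarrow> real) \<Rightarrow> 'r \<Rightarrow> real" where
  "reservoir_weight \<beta> E k = exp (- \<beta> * E k) / (\<Sum>\<^sub>\<infinity>l. exp (- \<beta> * E l))"

definition unitary_op :: "('a \<Rightarrow> 'a \<Rightarrow> complex) \<Rightarrow> bool" where
  "unitary_op U \<longleftrightarrow>
     (\<forall>x y. ((\<lambda>z. cnj (U z x) * U z y) has_sum of_bool (x = y)) UNIV) \<and>
     (\<forall>x y. ((\<lambda>z. U x z * cnj (U y z)) has_sum of_bool (x = y)) UNIV)"

text \<open>Matrix elements of \<open>U (\<rho> \<otimes> diag p) U\<^sup>*\<close>.\<close>

definition evolved_joint_state ::
  "('n::finite \<times> 'r \<Rightarrow> 'n \<times> 'r \<Rightarrow> complex) \<Rightarrow> 'n cmat \<Rightarrow> ('r \<Rightarrow> real)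
     \<Rightarrow> 'n \<times> 'r \<Rightarrow> 'n \<times> 'r \<Rightarrow> complex" where
  "evolved_joint_state U \<rho> p x y =
     (\<Sum>\<^sub>\<infinity>k. \<Sum>c\<in>UNIV. \<Sum>d\<in>UNIV.
        U x (c, k) * (\<rho> $ c $ d * complex_of_real (p k)) * cnj (U y (d, k)))"

definition reservoir_trace :: "('n::finite \<times> 'r \<Rightarrow> 'n \<times> 'r \<Rightarrow> complex) \<Rightarrow> 'n cmat" where
  "reservoir_trace R = (\<chi> a b. \<Sum>\<^sub>\<infinity>k. R (a, k) (b, k))"

section \<open>Thermodynamic force, flow and entropy production\<close>

definition partition_function :: "real \<Rightarrow> 'n::finite cmat \<Rightarrow> complex" where
  "partition_function \<beta> H = trace (mexp ((- \<beta>) *\<^sub>R H))"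

definition gibbs_state :: "real \<Rightarrow> 'n::finite cmat \<Rightarrow> 'n cmat" where
  "gibbs_state \<beta> H = (\<chi> i j. mexp ((- \<beta>) *\<^sub>R H) $ i $ j / partition_function \<beta> H)"

definition thermo_flow :: "'n::finite cmat \<Rightarrow> 'n cmat \<Rightarrow> 'n cmat" where
  "thermo_flow \<rho>dot \<sigma> = \<rho>dot ** \<sigma>"

definition thermo_force :: "'n::finite cmat \<Rightarrow> 'n cmat \<Rightarrow> 'n cmat" where
  "thermo_force \<rho> \<sigma> = matrix_inv \<sigma> ** (mlog \<sigma> - mlog \<rho>)"

definition heat_rate :: "'n::finite cmat \<Rightarrow> 'n cmat \<Rightarrow> complex" where
  "heat_rate \<rho>dot H = trace (\<rho>dot ** H)"

definition entropy_rate :: "'n::finite cmat \<Rightarrow> 'n cmat \<Rightarrow> complex" where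
  "entropy_rate \<rho> \<rho>dot = - trace (\<rho>dot ** mlog \<rho>)"

text \<open>The entropy balance, solved for the production term.\<close>

definition entropy_production ::
  "real \<Rightarrow> 'n::finite cmat \<Rightarrow> 'n cmat \<Rightarrow> 'n cmat \<Rightarrow> complex" where
  "entropy_production T H \<rho> \<rho>dot =
     entropy_rate \<rho> \<rho>dot - heat_rate \<rho>dot H / complex_of_real T"

subsection \<open>Density matrices with zero eigenvalues\<close>

text \<open>
  A pair \<open>(B, C)\<close> stands for the operator \<open>B + \<infinity> C\<close>. Differences of such operators are taken
  componentwise, by the group structure on pairs. As \<open>ln 0 = -\<infinity>\<close>, the logarithm of \<open>\<rho>\<close> has the
  infinite part \<open>-P\<close>, where \<open>P\<close> is the projection onto the kernel of \<open>\<rho>\<close> (\<open>P = 0\<close> if \<open>\<rho>\<close> is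
  invertible). Traces against such operators are extended reals, with \<open>\<infinity> * 0 = 0\<close>, in agreement
  with the limit of \<open>tr(X ln(\<rho> + \<epsilon>))\<close> for \<open>\<epsilon> \<rightarrow> 0+\<close>. The traces whose real parts are taken are
  real, all operators involved being Hermitian up to cancelling factors \<open>\<sigma>\<close> and \<open>\<sigma>\<^sup>-\<^sup>1\<close>.
\<close>

type_synonym 'n xmat = "'n cmat \<times> 'n cmat"

definition xlog :: "'n::finite cmat \<Rightarrow> 'n xmat" where
  "xlog \<rho> = (mlog \<rho>, - eigenprojection \<rho> 0)"

definition xmult :: "'n::finite cmat \<Rightarrow> 'n xmat \<Rightarrow> 'n xmat" where
  "xmult M A = (M ** fst A, M ** snd A)"

definition xtrace :: "'n::finite xmat \<Rightarrow> ereal" where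
  "xtrace A = ereal (Re (trace (fst A))) + \<infinity> * ereal (Re (trace (snd A)))"

definition xaffinity :: "'n::finite cmat \<Rightarrow> 'n cmat \<Rightarrow> 'n xmat" where
  "xaffinity \<rho> \<sigma> = xlog \<sigma> - xlog \<rho>"

definition xthermo_force :: "'n::finite cmat \<Rightarrow> 'n cmat \<Rightarrow> 'n xmat" where
  "xthermo_force \<rho> \<sigma> = xmult (matrix_inv \<sigma>) (xaffinity \<rho> \<sigma>)"

definition xentropy_rate :: "'n::finite cmat \<Rightarrow> 'n cmat \<Rightarrow> ereal" where
  "xentropy_rate \<rho> \<rho>dot = - xtrace (xmult \<rho>dot (xlog \<rho>))"

definition xentropy_production ::
  "real \<Rightarrow> 'n::finite cmat \<Rightarrow> 'n cmat \<Rightarrow> 'n cmat \<Rightarrow> ereal" where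
  "xentropy_production T H \<rho> \<rho>dot =
     xentropy_rate \<rho> \<rho>dot - ereal (Re (heat_rate \<rho>dot H) / T)"

end

theory Submission
  imports Defs
begin

text \<open>
  Since \<open>\<sigma> \<sigma>\<^sup>-\<^sup>1 = 1\<close>, the right-hand side is \<open>tr(\<rho>' (ln \<sigma> - ln \<rho>))\<close>. The spectral theorem for \<open>H\<close> gives
  \<open>ln \<sigma> = - \<beta> H - ln Z\<close>, and the term \<open>ln Z tr \<rho>'\<close> vanishes because the trace of \<open>\<rho>\<close> is
  conserved; so \<open>tr(\<rho>' ln \<sigma>)\<close> is minus the heat rate over \<open>T\<close>. For singular \<open>\<rho>\<close>, the infinite part
  of the affinity is that of \<open>- ln \<rho>\<close> alone, because \<open>\<sigma>\<close> has no kernel.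
\<close>

section \<open>Hermitian matrices\<close>

text \<open>A maximiser of the Rayleigh quotient on the unit sphere of \<open>W\<close> is an
  eigenvector. Invariance of \<open>W\<close> keeps the variation inside \<open>W\<close>.\<close>

lemma selfadjoint_eigenvector_exists:
  fixes f :: "'a::euclidean_space \<Rightarrow> 'a"
  assumes lin: "linear f" and adj: "\<And>v w. f v \<bullet> w = v \<bullet> f w"
    and W: "subspace W" "W \<noteq> {0}" and inv: "f ` W \<subseteq> W"
  shows "\<exists>v\<in>W. v \<noteq> 0 \<and> (\<exists>c. f v = c *\<^sub>R v)"
proof -
  obtain w where w: "w \<in> W" "w \<noteq> 0"
    using W subspace_0 by blast
  let ?K = "sphere 0 1 \<inter> W"
  have "w /\<^sub>R norm w \<in> ?K"
    using w W(1) by (simp add: subspace_scale)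
  then have "?K \<noteq> {}" by blast
  moreover have "compact ?K"
    by (intro compact_Int_closed compact_sphere closed_subspace W)
  moreover have "continuous_on ?K (\<lambda>x. x \<bullet> f x)"
    by (intro continuous_intros linear_continuous_on linear_conv_bounded_linear[THEN iffD1] lin)
  ultimately obtain v where v: "v \<in> ?K" and vmax: "\<And>x. x \<in> ?K \<Longrightarrow> x \<bullet> f x \<le> v \<bullet> f v"
    by (meson continuous_attains_sup)
  define c where "c = v \<bullet> f v"
  have vv: "v \<bullet> v = 1" and vW: "v \<in> W" and "v \<noteq> 0"
    using v by (auto simp: norm_eq_1)
  \<comment> \<open>Both sides are homogeneous of degree two, so the maximum on the sphere controls
    all of \<open>W\<close>.\<close>
  have bound: "x \<bullet> f x \<le> c * (x \<bullet> x)" if "x \<in> W" for x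
  proof (cases "x = 0")
    case True
    then show ?thesis by simp
  next
    case False
    then have "x /\<^sub>R norm x \<in> ?K"
      using that W(1) by (simp add: subspace_scale)
    from vmax[OF this] have "(x \<bullet> f x) / (norm x)\<^sup>2 \<le> c"
      by (simp add: c_def linear_scale[OF lin] power2_eq_square field_simps)
    then show ?thesis
      using False by (simp add: field_simps power2_norm_eq_inner)
  qed
  define g where "g x = c *\<^sub>R x - f x" for x
  have gW: "g x \<in> W" if "x \<in> W" for x
    using that inv W(1) by (auto simp: g_def intro!: subspace_diff subspace_scale)
  have pos: "0 \<le> x \<bullet> g x" if "x \<in> W" for x
    using bound[OF that] by (simp add: g_def inner_diff_right)
  have g_lin: "g (v + s *\<^sub>R u) = g v + s *\<^sub>R g u" for s u
    by (simp add: g_def linear_add[OF lin] linear_scale[OF lin] algebra_simps)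
  have vgv: "v \<bullet> g v = 0"
    by (simp add: g_def inner_diff_right vv c_def)
  define u where "u = g v"
  \<comment> \<open>\<open>g\<close> inherits self-adjointness from \<open>f\<close>, so
    \<open>g\<close> may be moved onto \<open>v\<close>.\<close>
  have vgu: "v \<bullet> g u = u \<bullet> u"
    unfolding u_def[symmetric]
    by (subst (2) u_def) (simp add: g_def inner_diff_left inner_diff_right adj)
  define a b where "a = u \<bullet> u" and "b = u \<bullet> g u"
  have uW: "u \<in> W" unfolding u_def by (rule gW[OF vW])
  have "b \<ge> 0" unfolding b_def by (rule pos[OF uW])
  \<comment> \<open>The form \<open>x \<bullet> g x\<close> is nonnegative on \<open>W\<close> and vanishes at \<open>v\<close>; moving from \<open>v\<close> in the
    direction \<open>- g v\<close> would make it negative unless \<open>g v = 0\<close>.\<close>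
  have quad: "0 \<le> 2 * s * a + s\<^sup>2 * b" for s
  proof -
    have "0 \<le> (v + s *\<^sub>R u) \<bullet> g (v + s *\<^sub>R u)"
      using W(1) vW uW by (intro pos subspace_add subspace_scale)
    also have "\<dots> = v \<bullet> g v + s * (v \<bullet> g u) + s * (u \<bullet> g v) + s\<^sup>2 * b"
      by (simp add: g_lin inner_add_left inner_add_right b_def power2_eq_square algebra_simps)
    also have "\<dots> = 2 * s * a + s\<^sup>2 * b"
      using vgv by (simp add: vgu a_def u_def[symmetric])
    finally show ?thesis .
  qed
  have "a = 0"
  proof (rule ccontr)
    assume "a \<noteq> 0"
    then have "a > 0" by (simp add: a_def)
    \<comment> \<open>With \<open>s = - a / (b + 1)\<close> the linear term outweighs the quadratic
      one; the added 1 covers \<open>b = 0\<close>.\<close>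
    have "2 * (- (a / (b + 1))) * a + (- (a / (b + 1)))\<^sup>2 * b = - (a\<^sup>2 * (b + 2)) / (b + 1)\<^sup>2"
      using \<open>b \<ge> 0\<close> by (simp add: divide_simps) (simp add: power2_eq_square algebra_simps)
    also have "\<dots> < 0"
      using \<open>b \<ge> 0\<close> \<open>a > 0\<close> by (simp add: divide_less_0_iff)
    finally show False using quad[of "- (a / (b + 1))"] by simp
  qed
  then have "f v = c *\<^sub>R v"
    by (simp add: a_def u_def g_def)
  with vW \<open>v \<noteq> 0\<close> show ?thesis by blast
qed

section \<open>Complex vectors as a real Euclidean space\<close>

lemma of_real_vector_scale: "complex_of_real x *s v = x *\<^sub>R v"
  by (simp add: vec_eq_iff) (simp add: scaleR_conv_of_real)

lemma matrix_vector_mult_scaleR_right: "M *v (c *\<^sub>R v) = c *\<^sub>R (M *v v)"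
  for M :: "complex ^ 'n ^ 'm"
  by (rule linear_scale) simp

lemma matrix_vector_mult_scaleR_left: "(c *\<^sub>R M) *v v = c *\<^sub>R (M *v v)"
  for M :: "complex ^ 'n ^ 'm"
  by (simp add: vec_eq_iff matrix_vector_mult_def scaleR_sum_right)

lemma mem_eigenspace: "v \<in> eigenspace A x \<longleftrightarrow> A *v v = x *\<^sub>R v"
  by (simp add: eigenspace_def of_real_vector_scale)

lemma inner_mult_left_cnj: "(a * b) \<bullet> c = b \<bullet> (cnj a * c)" for a b c :: complex
  by (simp add: inner_complex_def algebra_simps)

lemma hermitian_cnj: "hermitian A \<Longrightarrow> cnj (A $ i $ j) = A $ j $ i"
  unfolding hermitian_def by metis

text \<open>The real inner product is the real part of the Hermitian form, so the real Euclidean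
  theory of self-adjoint maps applies to \<open>A\<close>.\<close>

lemma hermitian_inner_commute:
  assumes "hermitian A"
  shows "(A *v v) \<bullet> w = v \<bullet> (A *v w)"
proof -
  have "(A *v v) \<bullet> w = (\<Sum>i\<in>UNIV. \<Sum>j\<in>UNIV. v $ j \<bullet> (cnj (A $ i $ j) * w $ i))"
    by (simp add: inner_vec_def matrix_vector_mult_def inner_sum_left inner_mult_left_cnj)
  also have "\<dots> = (\<Sum>j\<in>UNIV. \<Sum>i\<in>UNIV. v $ j \<bullet> (A $ j $ i * w $ i))"
    by (subst sum.swap) (simp add: hermitian_cnj[OF assms])
  also have "\<dots> = v \<bullet> (A *v w)"
    by (simp add: inner_vec_def matrix_vector_mult_def inner_sum_right)
  finally show ?thesis .
qed

text \<open>Spectral theorem: otherwise the orthogonal complement of the span would contain an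
  eigenvector, which would be orthogonal to itself. The real span suffices because each eigenspace
  is a complex subspace.\<close>

lemma hermitian_eigenspaces_span:
  fixes A :: "'n::finite cmat"
  assumes "hermitian A"
  shows "span (\<Union>x. eigenspace A x) = UNIV"
proof (rule ccontr)
  let ?V = "span (\<Union>x. eigenspace A x)"
  let ?W = "{w. \<forall>v\<in>?V. orthogonal v w}"
  assume "?V \<noteq> UNIV"
  then obtain a where "a \<noteq> 0" "\<And>v. v \<in> ?V \<Longrightarrow> a \<bullet> v = 0"
    using span_not_UNIV_orthogonal by blast
  then have "a \<in> ?W" "a \<noteq> 0"
    by (auto simp: orthogonal_def inner_commute)
  then have "?W \<noteq> {0}" by blast
  \<comment> \<open>By self-adjointness, invariance of \<open>?V\<close> passes to its complement
    \<open>?W\<close>.\<close>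
  have AV: "A *v v \<in> ?V" if "v \<in> ?V" for v
    using that
  proof (induction rule: span_induct_alt)
    case (step c x y)
    then obtain d where "A *v x = d *\<^sub>R x" by (auto simp: mem_eigenspace)
    with step have "A *v x \<in> ?V"
      by (metis span_base span_mul)
    with step show ?case
      by (simp add: matrix_vector_right_distrib matrix_vector_mult_scaleR_right span_add span_mul)
  qed (simp add: span_zero)
  have "(*v) A ` ?W \<subseteq> ?W"
    using AV hermitian_inner_commute[OF assms] by (force simp: orthogonal_def)
  then obtain w c where w: "w \<in> ?W" "w \<noteq> 0" "A *v w = c *\<^sub>R w"
    using selfadjoint_eigenvector_exists[of "(*v) A" ?W] \<open>?W \<noteq> {0}\<close>
      hermitian_inner_commute[OF assms] subspace_orthogonal_to_vectors[of ?V]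
    by auto
  then have "w \<in> ?V"
    by (auto simp: mem_eigenspace intro: span_base)
  with w show False by (auto simp: orthogonal_def)
qed

text \<open>Eigenvectors span, so operator identities reduce to scalar ones on each
  eigenspace.\<close>

lemma matrix_eq_on_eigenspaces:
  assumes "hermitian A" and "\<And>x v. v \<in> eigenspace A x \<Longrightarrow> B *v v = C *v v"
  shows "B = C"
proof -
  have "B *v v = C *v v" for v
    using linear_eq_on_span[of "(*v) B" "(*v) C" "\<Union>x. eigenspace A x" v]
      hermitian_eigenspaces_span[OF assms(1)] assms(2) by auto
  then show ?thesis by (simp add: matrix_eq)
qed

text \<open>One eigenvector per eigenvalue gives an orthogonal, hence independent, family.
  Finiteness ensures that sums over the spectrum do not collapse to the default 0.\<close>

lemma finite_real_eigenvalues: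
  fixes A :: "'n::finite cmat"
  assumes "hermitian A"
  shows "finite (real_eigenvalues A)"
proof -
  let ?S = "real_eigenvalues A"
  have "\<forall>x\<in>?S. \<exists>v. v \<noteq> 0 \<and> A *v v = x *\<^sub>R v"
    by (simp add: real_eigenvalues_def mem_eigenspace)
  from bchoice[OF this] obtain e where "\<forall>x\<in>?S. e x \<noteq> 0 \<and> A *v e x = x *\<^sub>R e x" ..
  then have e: "e x \<noteq> 0" "A *v e x = x *\<^sub>R e x" if "x \<in> ?S" for x
    using that by auto
  have orth: "e x \<bullet> e y = 0" if "x \<in> ?S" "y \<in> ?S" "x \<noteq> y" for x y
    using hermitian_inner_commute[OF assms, of "e x" "e y"] e that by auto
  have inj: "inj_on e ?S"
  proof (rule inj_onI, rule ccontr)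
    fix x y assume xy: "x \<in> ?S" "y \<in> ?S" "e x = e y" "x \<noteq> y"
    then have "e x \<bullet> e x = 0" using orth[of x y] by simp
    with e xy show False by simp
  qed
  have "pairwise orthogonal (e ` ?S)"
    using orth by (auto simp: pairwise_def orthogonal_def)
  moreover have "0 \<notin> e ` ?S" using e by force
  ultimately have "independent (e ` ?S)"
    by (rule pairwise_orthogonal_independent)
  then show ?thesis
    using independent_bound inj finite_image_iff by blast
qed

lemma hermitian_mult:
  assumes "hermitian A" "hermitian B" "A ** B = B ** A"
  shows "hermitian (A ** B)"
  unfolding hermitian_def
proof (intro allI)
  fix i j
  have "(A ** B) $ i $ j = (\<Sum>k\<in>UNIV. cnj (A $ k $ i) * cnj (B $ j $ k))"
    by (simp add: matrix_matrix_mult_def hermitian_cnj[OF assms(1)] hermitian_cnj[OF assms(2)])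
  also have "\<dots> = cnj ((B ** A) $ j $ i)"
    by (simp add: matrix_matrix_mult_def mult.commute)
  finally show "(A ** B) $ i $ j = cnj ((A ** B) $ j $ i)"
    using assms(3) by simp
qed

lemma hermitian_mat_real: "hermitian (mat (complex_of_real x))"
  by (auto simp: hermitian_def mat_def)

lemma hermitian_diff: "hermitian A \<Longrightarrow> hermitian B \<Longrightarrow> hermitian (A - B)"
  by (simp add: hermitian_def[of "A - B"] hermitian_cnj)

lemma hermitian_scaleR: "hermitian A \<Longrightarrow> hermitian (x *\<^sub>R A)"
  by (simp add: hermitian_def[of "x *\<^sub>R A"] hermitian_cnj)

lemma mat_real_mult_vector: "mat (complex_of_real y) *v v = y *\<^sub>R v"
  by (simp add: vec_eq_iff matrix_vector_mult_def mat_def if_distrib[of "\<lambda>x. x * _"] cong: if_cong)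
    (simp add: scaleR_conv_of_real)

section \<open>Spectral calculus\<close>

text \<open>\<open>Q\<close> is the Lagrange interpolation polynomial \<open>\<Prod>y\<in>Y. (A - y) / (x - y)\<close> in \<open>A\<close>.\<close>

lemma hermitian_separate_eigenspace:
  fixes A :: "'n::finite cmat"
  assumes "hermitian A" "finite Y" "x \<notin> Y"
  shows "\<exists>Q. hermitian Q \<and> A ** Q = Q ** A \<and> (\<forall>v\<in>eigenspace A x. Q *v v = v) \<and>
    (\<forall>y\<in>Y. \<forall>v\<in>eigenspace A y. Q *v v = 0)"
  using assms(2,3)
proof (induction rule: finite_induct)
  case empty
  have "hermitian (mat 1 :: 'n cmat)"
    using hermitian_mat_real[of 1] by simp
  then show ?case by (intro exI[of _ "mat 1"]) auto
next
  case (insert y Y)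
  then obtain Q where Q: "hermitian Q" "A ** Q = Q ** A"
    "\<And>v. v \<in> eigenspace A x \<Longrightarrow> Q *v v = v"
    "\<And>y v. y \<in> Y \<Longrightarrow> v \<in> eigenspace A y \<Longrightarrow> Q *v v = 0"
    by blast
  define B where "B = (1 / (x - y)) *\<^sub>R (A - mat (complex_of_real y))"
  have Bv: "B *v v = (1 / (x - y)) *\<^sub>R (A *v v - y *\<^sub>R v)" for v
    by (simp add: B_def matrix_vector_mult_scaleR_left matrix_vector_mult_diff_rdistrib
        mat_real_mult_vector)
  have ABv: "A *v (Q *v v) = Q *v (A *v v)" for v
    by (simp add: matrix_vector_mul_assoc Q(2))
  have BQ: "B *v (Q *v v) = Q *v (B *v v)" for v
    by (simp add: Bv ABv matrix_vector_mult_scaleR_right matrix_vector_mult_diff_distrib)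
  have BA: "B *v (A *v v) = A *v (B *v v)" for v
    by (simp add: Bv matrix_vector_mult_scaleR_right matrix_vector_mult_diff_distrib)
  have "hermitian (B ** Q)"
    using assms(1) Q(1)
    by (intro hermitian_mult)
      (auto simp: B_def matrix_eq matrix_vector_mul_assoc[symmetric] BQ[unfolded B_def]
        intro!: hermitian_scaleR hermitian_diff hermitian_mat_real)
  moreover have "A ** (B ** Q) = B ** Q ** A"
    by (simp add: matrix_eq matrix_vector_mul_assoc[symmetric] BA[symmetric] ABv)
  moreover have "(B ** Q) *v v = v" if "v \<in> eigenspace A x" for v
    using that insert.prems Q(3)[OF that]
    by (simp add: matrix_vector_mul_assoc[symmetric] Bv mem_eigenspace scaleR_left_diff_distrib[symmetric])
  moreover have "(B ** Q) *v v = 0" if "z \<in> insert y Y" "v \<in> eigenspace A z" for v z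
  proof (cases "z = y")
    case True
    with that show ?thesis
      by (simp add: matrix_vector_mul_assoc[symmetric] BQ) (simp add: Bv mem_eigenspace)
  next
    case False
    with that show ?thesis
      by (simp add: matrix_vector_mul_assoc[symmetric] Q(4))
  qed
  ultimately show ?case by blast
qed

section \<open>Eigenprojections\<close>

text \<open>Each projection fixes the range of the other: \<open>P ** Q = Q\<close> and
  \<open>Q ** P = P\<close>. The adjoint of the second identity is
  \<open>P ** Q = P\<close>.\<close>

lemma orthogonal_projection_unique:
  assumes "hermitian P" "P ** P = P" "hermitian Q" "Q ** Q = Q"
    and "range ((*v) P) = range ((*v) Q)"
  shows "P = Q"
proof -
  have "P *v (Q *v v) = Q *v v" for v
    using assms(2,5) by (metis matrix_vector_mul_assoc rangeE rangeI)
  then have PQ: "P ** Q = Q"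
    by (simp add: matrix_eq matrix_vector_mul_assoc[symmetric])
  have "Q *v (P *v v) = P *v v" for v
    using assms(4,5) by (metis matrix_vector_mul_assoc rangeE rangeI)
  then have QP: "(P *v v) \<bullet> w = v \<bullet> (P *v (Q *v w))" for v w
    by (metis assms(1,3) hermitian_inner_commute)
  have "P *v w = P *v (Q *v w)" for w
    by (rule vector_eq_rdot[THEN iffD1]) (metis QP assms(1) hermitian_inner_commute inner_commute)
  with PQ show ?thesis
    by (simp add: matrix_eq matrix_vector_mul_assoc)
qed

text \<open>Resolves the definite description: exhibiting one suitable projection is enough.\<close>

lemma eigenprojection_eqI:
  assumes "hermitian P" "P ** P = P" "range ((*v) P) = eigenspace A x"
  shows "eigenprojection A x = P"
  unfolding eigenprojection_def
proof (rule the_equality)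
  fix Q assume "hermitian Q \<and> Q ** Q = Q \<and> range ((*v) Q) = eigenspace A x"
  then show "Q = P"
    using orthogonal_projection_unique[OF _ _ assms(1,2), of Q] assms(3) by simp
qed (intro conjI assms)

lemma eigenprojection_trivial:
  assumes "eigenspace A x = {0}"
  shows "eigenprojection A x = 0"
  by (rule eigenprojection_eqI) (simp_all add: assms hermitian_def matrix_eq matrix_vector_mul_assoc[symmetric])

lemma eigenspace_nontrivial_iff: "x \<in> real_eigenvalues A \<longleftrightarrow> eigenspace A x \<noteq> {0}"
proof -
  have "0 \<in> eigenspace A x" by (simp add: mem_eigenspace)
  then show ?thesis unfolding real_eigenvalues_def by blast
qed

text \<open>The interpolation polynomial that separates \<open>x\<close> from the rest of the
  spectrum is the eigenprojection.\<close>

lemma hermitian_eigenprojection: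
  fixes A :: "'n::finite cmat"
  assumes "hermitian A"
  shows "hermitian (eigenprojection A x)"
    and "v \<in> eigenspace A x \<Longrightarrow> eigenprojection A x *v v = v"
    and "v \<in> eigenspace A y \<Longrightarrow> y \<noteq> x \<Longrightarrow> eigenprojection A x *v v = 0"
    and "eigenprojection A x *v w \<in> eigenspace A x"
proof -
  obtain Q where Q: "hermitian Q" "\<And>v. v \<in> eigenspace A x \<Longrightarrow> Q *v v = v"
    "\<And>y v. y \<in> real_eigenvalues A - {x} \<Longrightarrow> v \<in> eigenspace A y \<Longrightarrow> Q *v v = 0"
    using hermitian_separate_eigenspace[OF assms, of "real_eigenvalues A - {x}" x]
      finite_real_eigenvalues[OF assms] by auto
  \<comment> \<open>If \<open>y\<close> is not an eigenvalue, its eigenspace holds only 0, so the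
    vanishing extends to every \<open>y\<close> other than \<open>x\<close>.\<close>
  have Q0: "Q *v v = 0" if "v \<in> eigenspace A y" "y \<noteq> x" for v y
  proof (cases "v = 0")
    case False
    with that(1) have "y \<in> real_eigenvalues A" by (auto simp: real_eigenvalues_def)
    with that Q(3) show ?thesis by blast
  qed simp
  have "A ** Q = x *\<^sub>R Q"
  proof (rule matrix_eq_on_eigenspaces[OF assms])
    fix y v assume v: "v \<in> eigenspace A y"
    show "(A ** Q) *v v = (x *\<^sub>R Q) *v v"
    proof (cases "y = x")
      case True
      then show ?thesis
        using Q(2)[of v] v
        by (simp add: matrix_vector_mul_assoc[symmetric] matrix_vector_mult_scaleR_left mem_eigenspace)
    next
      case False
      then show ?thesis
        using Q0[OF v]
        by (simp add: matrix_vector_mul_assoc[symmetric] matrix_vector_mult_scaleR_left)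
    qed
  qed
  then have range: "Q *v v \<in> eigenspace A x" for v
    by (simp add: mem_eigenspace matrix_vector_mul_assoc matrix_vector_mult_scaleR_left)
  have "range ((*v) Q) = eigenspace A x"
    using range Q(2) by (metis image_subset_iff rangeI subsetI subset_antisym)
  moreover have "Q ** Q = Q"
    by (simp add: matrix_eq matrix_vector_mul_assoc[symmetric] Q(2)[OF range])
  ultimately have eq: "eigenprojection A x = Q"
    using Q(1) by (intro eigenprojection_eqI)
  show "hermitian (eigenprojection A x)"
    "v \<in> eigenspace A x \<Longrightarrow> eigenprojection A x *v v = v"
    "v \<in> eigenspace A y \<Longrightarrow> y \<noteq> x \<Longrightarrow> eigenprojection A x *v v = 0"
    "eigenprojection A x *v w \<in> eigenspace A x"
    unfolding eq by (fact Q(1) Q(2) Q0 range)+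
qed

lemma matrix_vector_mult_sum_left:
  "(\<Sum>x\<in>S. F x) *v v = (\<Sum>x\<in>S. F x *v v)"
  by (induction S rule: infinite_finite_induct) (simp_all add: matrix_vector_mult_add_rdistrib)

text \<open>Functional calculus in the form of \<open>mlog\<close> with a general \<open>f\<close>,
  so that exponential and logarithm can be composed.\<close>

definition spectral_apply :: "(real \<Rightarrow> real) \<Rightarrow> 'n::finite cmat \<Rightarrow> 'n cmat" where
  "spectral_apply f A = (\<Sum>x\<in>real_eigenvalues A. f x *\<^sub>R eigenprojection A x)"

lemma spectral_apply_eigenvector:
  assumes "hermitian A" "v \<in> eigenspace A x"
  shows "spectral_apply f A *v v = f x *\<^sub>R v"
proof (cases "v = 0")
  \<comment> \<open>A nonzero \<open>v\<close> makes \<open>x\<close> an eigenvalue, so the sum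
    contains the index \<open>x\<close>, and only that term survives.\<close>
  case False
  have "spectral_apply f A *v v = (\<Sum>y\<in>real_eigenvalues A. if y = x then f x *\<^sub>R v else 0)"
    unfolding spectral_apply_def matrix_vector_mult_sum_left
    by (intro sum.cong refl)
      (use hermitian_eigenprojection(2,3)[OF assms] in
        \<open>auto simp: matrix_vector_mult_scaleR_left\<close>)
  also have "\<dots> = f x *\<^sub>R v"
    using False assms(2) finite_real_eigenvalues[OF assms(1)]
    by (auto simp: real_eigenvalues_def)
  finally show ?thesis .
qed simp

lemma spectral_apply_unique:
  assumes "hermitian A" "\<And>x v. v \<in> eigenspace A x \<Longrightarrow> B *v v = f x *\<^sub>R v"
  shows "spectral_apply f A = B"
proof (rule matrix_eq_on_eigenspaces[OF assms(1)])
  fix x v assume v: "v \<in> eigenspace A x"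
  show "spectral_apply f A *v v = B *v v"
    unfolding spectral_apply_eigenvector[OF assms(1) v] assms(2)[OF v] ..
qed

text \<open>Powers of \<open>A\<close> act on eigenspaces by powers of the eigenvalue; the sum over
  the finite spectrum then lets the scalar exponential series converge eigenvalue by
  eigenvalue.\<close>

lemma mexp_hermitian:
  fixes A :: "'n::finite cmat"
  assumes "hermitian A"
  shows "mexp A = spectral_apply exp A"
proof -
  have pow: "((**) A ^^ k) (mat 1) = spectral_apply (\<lambda>x. x ^ k) A" for k
  proof (rule spectral_apply_unique[OF assms, symmetric])
    fix x v assume "v \<in> eigenspace A x"
    then show "((**) A ^^ k) (mat 1) *v v = x ^ k *\<^sub>R v"
      by (induction k)
        (simp_all add: matrix_vector_mul_assoc[symmetric] matrix_vector_mult_scaleR_right mem_eigenspace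
          mult.commute)
  qed
  have "(\<lambda>k. spectral_apply (\<lambda>x. x ^ k /\<^sub>R fact k) A) sums spectral_apply exp A"
    unfolding spectral_apply_def by (intro sums_sum sums_scaleR_left exp_converges)
  moreover have "spectral_apply (\<lambda>x. x ^ k /\<^sub>R fact k) A = ((**) A ^^ k) (mat 1) /\<^sub>R fact k" for k
    by (simp add: pow spectral_apply_def scaleR_sum_right)
  ultimately show ?thesis
    unfolding mexp_def by (simp add: sums_iff)
qed

text \<open>Spectral mapping. Injectivity of \<open>g\<close> keeps distinct eigenvalues from
  merging, so eigenspaces are only relabelled.\<close>

lemma spectral_apply_spectrum:
  fixes A :: "'n::finite cmat"
  assumes "hermitian A" "inj g"
  shows "eigenspace (spectral_apply g A) (g x) = eigenspace A x"
    and "real_eigenvalues (spectral_apply g A) = g ` real_eigenvalues A"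
proof -
  let ?B = "spectral_apply g A" and ?P = "eigenprojection A"
  have one: "spectral_apply (\<lambda>_. 1) A = mat 1"
    by (rule spectral_apply_unique[OF assms(1)]) simp
  have PB: "?P z *v (?B *v v) = g z *\<^sub>R (?P z *v v)" for z v
  proof -
    have "?P z ** ?B = g z *\<^sub>R ?P z"
    proof (rule matrix_eq_on_eigenspaces[OF assms(1)])
      fix y v assume "v \<in> eigenspace A y"
      then show "(?P z ** ?B) *v v = (g z *\<^sub>R ?P z) *v v"
        using assms(1) hermitian_eigenprojection(2,3)[OF assms(1), of v]
        by (cases "y = z") (simp_all add: matrix_vector_mul_assoc[symmetric]
          spectral_apply_eigenvector matrix_vector_mult_scaleR_right matrix_vector_mult_scaleR_left)
    qed
    then show ?thesis
      by (metis matrix_vector_mul_assoc matrix_vector_mult_scaleR_left)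
  qed
  \<comment> \<open>Resolution of the identity, obtained from the constant function 1.\<close>
  have resolve: "v = (\<Sum>z\<in>real_eigenvalues A. ?P z *v v)" for v
  proof -
    have "v = spectral_apply (\<lambda>_. 1) A *v v" by (simp add: one)
    then show ?thesis by (simp add: spectral_apply_def matrix_vector_mult_sum_left)
  qed
  \<comment> \<open>Projecting the eigenvalue equation by \<open>?P z\<close> gives the eigenvalue
    both as \<open>y\<close> and as \<open>g z\<close>.\<close>
  have zero: "?P z *v v = 0" if "v \<in> eigenspace ?B y" "y \<noteq> g z" for v y z
  proof -
    have "y *\<^sub>R (?P z *v v) = g z *\<^sub>R (?P z *v v)"
      using PB[of z v] that(1) by (simp add: mem_eigenspace matrix_vector_mult_scaleR_right)
    then show ?thesis using that(2) by simp
  qed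
  show es: "eigenspace ?B (g x) = eigenspace A x" for x
  proof (intro subset_antisym subsetI)
    fix v assume v: "v \<in> eigenspace ?B (g x)"
    have "v = (\<Sum>z\<in>real_eigenvalues A. if z = x then ?P x *v v else 0)"
      by (subst (1) resolve, intro sum.cong refl)
        (use zero[OF v] assms(2) in \<open>auto simp: inj_eq\<close>)
    also have "\<dots> = (if x \<in> real_eigenvalues A then ?P x *v v else 0)"
      using finite_real_eigenvalues[OF assms(1)] by simp
    also have "\<dots> \<in> eigenspace A x"
      using hermitian_eigenprojection(4)[OF assms(1)] by (simp add: mem_eigenspace)
    finally show "v \<in> eigenspace A x" .
  next
    fix v assume "v \<in> eigenspace A x"
    then show "v \<in> eigenspace ?B (g x)"
      using spectral_apply_eigenvector[OF assms(1)] by (simp add: mem_eigenspace[of v ?B])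
  qed
  show "real_eigenvalues ?B = g ` real_eigenvalues A"
  proof (intro subset_antisym subsetI)
    fix y assume "y \<in> real_eigenvalues ?B"
    then obtain v where v: "v \<noteq> 0" "v \<in> eigenspace ?B y"
      by (auto simp: real_eigenvalues_def)
    show "y \<in> g ` real_eigenvalues A"
    proof (rule ccontr)
      assume "y \<notin> g ` real_eigenvalues A"
      then have "?P z *v v = 0" if "z \<in> real_eigenvalues A" for z
        using zero[OF v(2)] that by blast
      then have "v = 0" using resolve[of v] by simp
      with v show False by simp
    qed
  next
    fix y assume "y \<in> g ` real_eigenvalues A"
    then show "y \<in> real_eigenvalues ?B"
      using es by (auto simp: eigenspace_nontrivial_iff)
  qed
qed

text \<open>An eigenprojection depends only on its eigenspace, so reindexing the spectrum by
  \<open>g\<close> suffices.\<close>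

lemma mlog_spectral_apply:
  fixes A :: "'n::finite cmat"
  assumes "hermitian A" "inj g"
  shows "mlog (spectral_apply g A) = spectral_apply (\<lambda>x. ln (g x)) A"
proof -
  have "eigenprojection (spectral_apply g A) (g x) = eigenprojection A x" for x
    by (simp add: eigenprojection_def spectral_apply_spectrum[OF assms])
  moreover have "inj_on g (real_eigenvalues A)"
    using assms(2) inj_on_subset by blast
  ultimately show ?thesis
    unfolding mlog_def spectral_apply_spectrum(2)[OF assms]
    by (simp add: sum.reindex spectral_apply_def)
qed

section \<open>Traces of projections and of the exponential\<close>

text \<open>\<open>P\<close> is the product of itself with its adjoint, so its trace is the squared
  Frobenius norm, real and nonnegative.\<close>

lemma trace_idempotent_hermitian:
  assumes "hermitian P" "P ** P = P"
  shows "trace P = complex_of_real (\<Sum>i\<in>UNIV. \<Sum>j\<in>UNIV. (norm (P $ i $ j))\<^sup>2)"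
proof -
  have "trace P = (\<Sum>i\<in>UNIV. \<Sum>j\<in>UNIV. P $ i $ j * P $ j $ i)"
    by (subst assms(2)[symmetric]) (simp add: trace_def matrix_matrix_mult_def)
  also have "\<dots> = (\<Sum>i\<in>UNIV. \<Sum>j\<in>UNIV. P $ i $ j * cnj (P $ i $ j))"
    by (simp add: hermitian_cnj[OF assms(1)])
  finally show ?thesis unfolding of_real_sum complex_norm_square .
qed

lemma trace_sum: "trace (\<Sum>x\<in>S. F x) = (\<Sum>x\<in>S. trace (F x))" for F :: "'a \<Rightarrow> 'n::finite cmat"
  by (induction S rule: infinite_finite_induct) (simp_all add: trace_def sum.distrib)

lemma trace_scaleR: "trace (c *\<^sub>R M) = c *\<^sub>R trace M" for M :: "'n::finite cmat"
  by (simp add: trace_def scaleR_sum_right)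

text \<open>The trace is the sum of \<open>exp x\<close> weighted by \<open>d x\<close>, the trace
  of the eigenprojection. The weights are nonnegative and sum to the dimension, so one of them is
  positive.\<close>

lemma trace_mexp_pos:
  fixes A :: "'n::finite cmat"
  assumes "hermitian A"
  obtains z where "z > 0" "trace (mexp A) = complex_of_real z"
proof -
  define d where "d x = (\<Sum>i\<in>UNIV. \<Sum>j\<in>UNIV. (norm (eigenprojection A x $ i $ j))\<^sup>2)" for x
  have tr: "trace (eigenprojection A x) = complex_of_real (d x)" for x
    unfolding d_def
    by (rule trace_idempotent_hermitian)
      (simp_all add: assms hermitian_eigenprojection matrix_eq matrix_vector_mul_assoc[symmetric])
  have sp: "trace (spectral_apply f A) = complex_of_real (\<Sum>x\<in>real_eigenvalues A. f x * d x)" for f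
    by (simp add: spectral_apply_def trace_sum trace_scaleR tr) (simp add: scaleR_conv_of_real)
  have "spectral_apply (\<lambda>_. 1) A = mat 1"
    by (rule spectral_apply_unique[OF assms]) simp
  with sp[of "\<lambda>_. 1"] have "complex_of_real (\<Sum>x\<in>real_eigenvalues A. d x) = of_real (real CARD('n))"
    by (simp add: trace_I)
  then have "(\<Sum>x\<in>real_eigenvalues A. d x) \<noteq> 0"
    unfolding of_real_eq_iff by simp
  then obtain x where "x \<in> real_eigenvalues A" "d x \<noteq> 0"
    by (meson sum.neutral)
  moreover have "d y \<ge> 0" for y
    by (simp add: d_def sum_nonneg)
  ultimately have "(\<Sum>x\<in>real_eigenvalues A. exp x * d x) > 0"
    by (intro sum_pos2[of _ x]) (auto simp: finite_real_eigenvalues assms order_less_le)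
  then show ?thesis
    using that sp[of exp] by (simp add: mexp_hermitian assms)
qed

section \<open>Gibbs states\<close>

text \<open>Written as a function of \<open>- \<beta> H\<close> rather than of \<open>H\<close>, so
  that the function is injective for every \<open>\<beta>\<close>, including 0.\<close>

lemma gibbs_state_spectral:
  fixes H :: "'n::finite cmat"
  assumes "hermitian H"
  obtains z where "z > 0"
    "gibbs_state \<beta> H = spectral_apply (\<lambda>x. exp x / z) ((- \<beta>) *\<^sub>R H)"
proof -
  let ?A = "(- \<beta>) *\<^sub>R H"
  have A: "hermitian ?A" by (rule hermitian_scaleR[OF assms])
  obtain z where z: "z > 0" "trace (mexp ?A) = complex_of_real z"
    using trace_mexp_pos[OF A] by blast
  have "gibbs_state \<beta> H = (1 / z) *\<^sub>R mexp ?A"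
    unfolding gibbs_state_def partition_function_def z(2)
    by (simp add: vec_eq_iff) (simp add: scaleR_conv_of_real field_simps)
  also have "\<dots> = spectral_apply (\<lambda>x. exp x / z) ?A"
    unfolding mexp_hermitian[OF A] spectral_apply_def by (simp add: scaleR_sum_right)
  finally show ?thesis using that z(1) by blast
qed

lemma inj_exp_divide: "z > 0 \<Longrightarrow> inj (\<lambda>x. exp x / z :: real)"
  by (auto simp: inj_def)

text \<open>\<open>ln (exp x / z) = x - ln z\<close> on the spectrum. The constant stays anonymous:
  a multiple of the identity is invisible to a traceless \<open>\<rho>dot\<close>.\<close>

lemma mlog_gibbs_state:
  fixes H :: "'n::finite cmat"
  assumes "hermitian H"
  obtains c where "mlog (gibbs_state \<beta> H) = (- \<beta>) *\<^sub>R H - c *\<^sub>R mat 1"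
proof -
  let ?A = "(- \<beta>) *\<^sub>R H"
  have A: "hermitian ?A" by (rule hermitian_scaleR[OF assms])
  obtain z where z: "z > 0" "gibbs_state \<beta> H = spectral_apply (\<lambda>x. exp x / z) ?A"
    using gibbs_state_spectral[OF assms] by blast
  have "mlog (gibbs_state \<beta> H) = spectral_apply (\<lambda>x. x - ln z) ?A"
    unfolding z(2) mlog_spectral_apply[OF A inj_exp_divide[OF z(1)]]
    using z(1) by (simp add: ln_div)
  also have "\<dots> = ?A - ln z *\<^sub>R mat 1"
  proof (rule spectral_apply_unique[OF A])
    fix x v assume "v \<in> eigenspace ?A x"
    then show "(?A - ln z *\<^sub>R mat 1) *v v = (x - ln z) *\<^sub>R v"
      by (simp only: matrix_vector_mult_diff_rdistrib mem_eigenspace matrix_vector_mult_scaleR_left[of "ln z"]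
          matrix_vector_mul_lid scaleR_left_diff_distrib)
  qed
  finally show ?thesis by (rule that)
qed

text \<open>\<open>matrix_inv\<close> is a choice, so a two-sided inverse must be exhibited: the
  reciprocal function on the spectrum.\<close>

lemma gibbs_state_mult_inv:
  fixes H :: "'n::finite cmat"
  assumes "hermitian H"
  shows "gibbs_state \<beta> H ** matrix_inv (gibbs_state \<beta> H) = mat 1"
proof -
  let ?A = "(- \<beta>) *\<^sub>R H"
  have A: "hermitian ?A" by (rule hermitian_scaleR[OF assms])
  obtain z where z: "z > 0" "gibbs_state \<beta> H = spectral_apply (\<lambda>x. exp x / z) ?A"
    using gibbs_state_spectral[OF assms] by blast
  let ?I = "spectral_apply (\<lambda>x. z / exp x) ?A"
  have "gibbs_state \<beta> H ** ?I = mat 1"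
    unfolding z(2)
  proof (rule matrix_eq_on_eigenspaces[OF A])
    fix x v assume v: "v \<in> eigenspace ?A x"
    show "(spectral_apply (\<lambda>x. exp x / z) ?A ** ?I) *v v = mat 1 *v v"
      unfolding matrix_vector_mul_assoc[symmetric] spectral_apply_eigenvector[OF A v]
        matrix_vector_mult_scaleR_right
      using z(1) by simp
  qed
  then have "\<exists>B. gibbs_state \<beta> H ** B = mat 1 \<and> B ** gibbs_state \<beta> H = mat 1"
    using matrix_left_right_inverse by blast
  then show ?thesis
    unfolding matrix_inv_def by (metis (mono_tags, lifting) someI_ex)
qed

text \<open>The spectrum is strictly positive, so the logarithm of a Gibbs state has no infinite
  part.\<close>

lemma eigenprojection_gibbs_state_0:
  fixes H :: "'n::finite cmat"
  assumes "hermitian H"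
  shows "eigenprojection (gibbs_state \<beta> H) 0 = 0"
proof -
  have A: "hermitian ((- \<beta>) *\<^sub>R H)" by (rule hermitian_scaleR[OF assms])
  obtain z where z: "z > 0"
    "gibbs_state \<beta> H = spectral_apply (\<lambda>x. exp x / z) ((- \<beta>) *\<^sub>R H)"
    using gibbs_state_spectral[OF assms] by blast
  have "0 \<notin> real_eigenvalues (gibbs_state \<beta> H)"
    unfolding z(2) spectral_apply_spectrum(2)[OF A inj_exp_divide[OF z(1)]]
    using z(1) by auto
  then show ?thesis
    by (intro eigenprojection_trivial) (simp add: eigenspace_nontrivial_iff)
qed

lemma trace_derivative_eq_0:
  fixes \<rho> :: "real \<Rightarrow> 'n::finite cmat"
  assumes "(\<rho> has_vector_derivative \<rho>dot) (at t within {0..})" "t \<ge> 0"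
    and "\<And>s. s \<ge> 0 \<Longrightarrow> trace (\<rho> s) = c"
  shows "trace \<rho>dot = 0"
proof -
  have "linear (trace :: 'n cmat \<Rightarrow> complex)"
    by (rule linearI) (simp_all add: trace_add trace_scaleR)
  then have "((\<lambda>s. trace (\<rho> s)) has_vector_derivative trace \<rho>dot) (at t within {0..})"
    using bounded_linear.has_vector_derivative[OF _ assms(1)] linear_conv_bounded_linear by blast
  then have "((\<lambda>_. c) has_vector_derivative trace \<rho>dot) (at t within {0..})"
    by (rule has_vector_derivative_transform[rotated 2]) (use assms in auto)
  \<comment> \<open>Uniqueness of the derivative requires that \<open>t\<close> not be isolated; at
    \<open>t = 0\<close> only the right side is available.\<close>
  moreover have "at t within {0..} \<noteq> bot"
  proof -
    have "at t within {t<..} \<le> at t within {0..}"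
      using assms(2) by (intro at_le) auto
    then show ?thesis
      using trivial_limit_at_right_real[of t] by (metis bot.extremum_uniqueI)
  qed
  ultimately show ?thesis
    by (rule vector_derivative_unique_within[rotated, OF _ has_vector_derivative_const])
qed

section \<open>Linearity of products and traces\<close>

lemma matrix_mult_diff_right: "M ** (A - B) = M ** A - M ** B" for M :: "'n::finite cmat"
  by (simp add: vec_eq_iff matrix_matrix_mult_def sum_subtractf right_diff_distrib)

lemma matrix_mult_scaleR_right: "M ** (c *\<^sub>R A) = c *\<^sub>R (M ** A)" for M :: "'n::finite cmat"
  by (simp add: vec_eq_iff matrix_matrix_mult_def scaleR_sum_right)

lemma matrix_mult_minus_right: "M ** (- A) = - (M ** A)" for M :: "'n::finite cmat"
  by (simp add: vec_eq_iff matrix_matrix_mult_def sum_negf)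

lemma trace_uminus: "trace (- A) = - trace A" for A :: "'n::finite cmat"
  by (simp add: trace_def sum_negf)

theorem mainTheorem1:
  fixes H :: "real \<Rightarrow> complex ^ 'n::finite ^ 'n"
    and \<rho> :: "real \<Rightarrow> complex ^ 'n ^ 'n"
    and \<Lambda> :: "real \<Rightarrow> complex ^ 'n ^ 'n \<Rightarrow> complex ^ 'n ^ 'n"
    and E :: "'r \<Rightarrow> real"
    and U :: "real \<Rightarrow> 'n \<times> 'r \<Rightarrow> 'n \<times> 'r \<Rightarrow> complex"
    and T \<beta> t :: real
    and \<rho>dot :: "complex ^ 'n ^ 'n"
  assumes temperature: "T > 0" "\<beta> = 1 / T"
    and hamiltonian: "\<And>s. s \<ge> 0 \<Longrightarrow> hermitian (H s)"
    and reservoir: "(\<lambda>k. exp (- \<beta> * E k)) summable_on UNIV"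
    and unitary: "\<And>s. s \<ge> 0 \<Longrightarrow> unitary_op (U s)" "U 0 = (\<lambda>x y. of_bool (x = y))"
    and initial: "density_matrix (\<rho> 0)"
    and reduced: "\<And>s. s \<ge> 0 \<Longrightarrow>
      \<rho> s = reservoir_trace (evolved_joint_state (U s) (\<rho> 0) (reservoir_weight \<beta> E))"
    and channel: "\<And>s. s \<ge> 0 \<Longrightarrow> cptp (\<Lambda> s)" "\<And>s. s \<ge> 0 \<Longrightarrow> \<rho> s = \<Lambda> s (\<rho> 0)"
    and time: "t \<ge> 0"
    and derivative: "(\<rho> has_vector_derivative \<rho>dot) (at t within {0..})"
  shows "(invertible (\<rho> t) \<longrightarrow>
            entropy_production T (H t) (\<rho> t) \<rho>dot =
              trace (thermo_flow \<rho>dot (gibbs_state \<beta> (H t)) **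
                     thermo_force (\<rho> t) (gibbs_state \<beta> (H t)))) \<and>
         xentropy_production T (H t) (\<rho> t) \<rho>dot =
           xtrace (xmult (thermo_flow \<rho>dot (gibbs_state \<beta> (H t)))
                         (xthermo_force (\<rho> t) (gibbs_state \<beta> (H t))))"
proof -
  let ?\<sigma> = "gibbs_state \<beta> (H t)"
  have herm: "hermitian (H t)" using hamiltonian time by simp
  have "trace (\<rho> s) = trace (\<rho> 0)" if "s \<ge> 0" for s
    using channel that unfolding cptp_def by metis
  then have traceless: "trace \<rho>dot = 0"
    by (rule trace_derivative_eq_0[OF derivative time])
  \<comment> \<open>Stated for arbitrary \<open>M\<close> to serve the finite and the infinite
    component of the force alike.\<close>
  have cancel: "thermo_flow \<rho>dot ?\<sigma> ** (matrix_inv ?\<sigma> ** M) = \<rho>dot ** M" for M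
    unfolding thermo_flow_def
    by (metis gibbs_state_mult_inv[OF herm] matrix_mul_assoc matrix_mul_rid)
  have heat: "trace (\<rho>dot ** mlog ?\<sigma>) = - heat_rate \<rho>dot (H t) / complex_of_real T"
  proof -
    obtain c where "mlog ?\<sigma> = (- \<beta>) *\<^sub>R H t - c *\<^sub>R mat 1"
      using mlog_gibbs_state[OF herm] by blast
    then have "trace (\<rho>dot ** mlog ?\<sigma>) = (- \<beta>) *\<^sub>R heat_rate \<rho>dot (H t)"
      by (simp only: matrix_mult_diff_right matrix_mult_scaleR_right matrix_mul_rid trace_sub
          trace_scaleR traceless heat_rate_def scaleR_zero_right diff_zero)
    then show ?thesis
      using temperature by (simp add: scaleR_conv_of_real)
  qed
  have "entropy_production T (H t) (\<rho> t) \<rho>dot =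
      trace (thermo_flow \<rho>dot ?\<sigma> ** thermo_force (\<rho> t) ?\<sigma>)"
    unfolding thermo_force_def cancel
    by (simp add: entropy_production_def entropy_rate_def matrix_mult_diff_right trace_sub heat)
  moreover have "xentropy_production T (H t) (\<rho> t) \<rho>dot =
      xtrace (xmult (thermo_flow \<rho>dot ?\<sigma>) (xthermo_force (\<rho> t) ?\<sigma>))"
  proof -
    let ?b = "Re (heat_rate \<rho>dot (H t)) / T" and ?a = "Re (trace (\<rho>dot ** mlog (\<rho> t)))"
      and ?c = "Re (trace (\<rho>dot ** eigenprojection (\<rho> t) 0))"
    have "Re (trace (\<rho>dot ** mlog ?\<sigma>)) = - ?b"
      by (simp add: heat)
    then have "xtrace (xmult (thermo_flow \<rho>dot ?\<sigma>) (xthermo_force (\<rho> t) ?\<sigma>)) =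
        ereal (- ?b - ?a) + \<infinity> * ereal ?c"
      by (simp add: xthermo_force_def xmult_def xaffinity_def xlog_def xtrace_def cancel
          eigenprojection_gibbs_state_0[OF herm] matrix_mult_diff_right trace_sub)
    moreover have "xentropy_production T (H t) (\<rho> t) \<rho>dot =
        - (ereal ?a + \<infinity> * ereal (- ?c)) - ereal ?b"
      by (simp add: xentropy_production_def xentropy_rate_def xmult_def xlog_def xtrace_def
          matrix_mult_minus_right trace_uminus)
    \<comment> \<open>If \<open>?c = 0\<close>, the convention \<open>\<infinity> * 0 = 0\<close>
      leaves the finite parts; otherwise both sides are the same infinity.\<close>
    moreover have "- (ereal ?a + \<infinity> * ereal (- ?c)) - ereal ?b = ereal (- ?b - ?a) + \<infinity> * ereal ?c"
      by (cases "?c" "0 :: real" rule: linorder_cases) simp_all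
    ultimately show ?thesis by simp
  qed
  ultimately show ?thesis by blast
qed

end
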